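(* Let $T$ be a colored triangulation of a combinatorial polygon. If the boundary word $\mathrm{Word}(T)$ is not contractible, then $T$ contains a tricolor triangle.
   Context: For $n\ge 3$, a combinatorial $n$-gon is an abstract cycle graph $G$ with $n$ vertices; a combinatorial polygon is a combinatorial $n$-gon for some $n\ge 3$. A triangulation of a combinatorial polygon $G$ is a finite collection $T$ of 3-element sets, called triangles, such that the underlying space $|T|$ (the topological space obtained by taking one geometric triangle for each element of $T$ and gluing them along common vertices and common edges, i.e. the geometric realization of the simplicial complex generated by $T$) is a topological disk whose boundary is equal to $G$. The vertices of $G$ are called the corners of $T$; $T$ may have additional (interior) vertices. A colored triangulation of $G$ is a triangulation $T$ of $G$ together with an assignment of a color (an element of an arbitrary set) to each vertex of $T$. The boundary word $\mathrm{Word}(T)$ is the cyclic word consisting of the colors of the corners, in cyclic order around $G$ (well defined up to reversal, which is immaterial). A colored triangle is tricolor if its three vertices have three different colors. A cyclic word $(X_1X_2\ldots X_n)$ is a finite string of letters considered up to cyclic permutation; indices are modulo $n$. For $n\ge 2$, a contracting step is: if the letters $X_{i-1},X_i,X_{i+1}$ are not all distinct, delete $X_i$. A cyclic word is contractible if there is a (possibly empty) sequence of contracting steps starting with it that results in a word consisting of a single letter. *)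

theory Defs
  imports "HOL-Analysis.Analysis"
begin

section \<open>Combinatorial polygons\<close>

text \<open>A graph is a pair of a vertex set and a set of edges (two-element vertex sets).\<close>

type_synonym 'a graph = "'a set \<times> 'a set set"

definition cycle_edges :: "'a list \<Rightarrow> 'a set set" where
  "cycle_edges vs = {{vs ! i, vs ! ((i + 1) mod length vs)} | i. i < length vs}"

definition cyclic_order :: "'a graph \<Rightarrow> 'a list \<Rightarrow> bool" where
  "cyclic_order G vs \<longleftrightarrow> distinct vs \<and> set vs = fst G \<and> cycle_edges vs = snd G"

definition combinatorial_ngon :: "nat \<Rightarrow> 'a graph \<Rightarrow> bool" where
  "combinatorial_ngon n G \<longleftrightarrow> n \<ge> 3 \<and> (\<exists>vs. length vs = n \<and> cyclic_order G vs)"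

definition combinatorial_polygon :: "'a graph \<Rightarrow> bool" where
  "combinatorial_polygon G \<longleftrightarrow> (\<exists>n\<ge>3. combinatorial_ngon n G)"

section \<open>Triangulations\<close>

definition generated_complex :: "'a set set \<Rightarrow> 'a set set" where
  "generated_complex F = {s. s \<noteq> {} \<and> (\<exists>t\<in>F. s \<subseteq> t)}"

text \<open>
  Points of the geometric realization are given by their barycentric coordinates, extended by 0.
  The realization carries the subspace topology of the product topology on \<open>'a \<Rightarrow> real\<close>;
  for a finite complex this is the topology obtained by gluing geometric simplices.
\<close>

definition realization :: "'a set set \<Rightarrow> ('a \<Rightarrow> real) set" where
  "realization K =
     {p. (\<forall>v. 0 \<le> p v) \<and> {v. p v \<noteq> 0} \<in> K \<and> (\<Sum>v | p v \<noteq> 0. p v) = 1}"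

text \<open>
  By invariance of domain, the image of the unit circle does not depend on the homeomorphism.
\<close>

definition disk_with_boundary :: "'b::topological_space set \<Rightarrow> 'b set \<Rightarrow> bool" where
  "disk_with_boundary D B \<longleftrightarrow>
     (\<exists>f g. homeomorphism (cball (0::complex) 1) D f g \<and> f ` sphere 0 1 = B)"

definition triangulates :: "'a set set \<Rightarrow> 'a graph \<Rightarrow> bool" where
  "triangulates T G \<longleftrightarrow>
     finite T \<and> (\<forall>t\<in>T. card t = 3) \<and>
     disk_with_boundary (realization (generated_complex T)) (realization (generated_complex (snd G)))"

section \<open>Colorings and cyclic words\<close>

text \<open>
  A cyclic word is represented by any list that spells it out. The corners of a polygon have
  several cyclic orders (differing by rotation and reversal), so a boundary word is a relation;
  the notions below do not depend on the choice (\<open>contractible_word_rotate\<close>, \<open>contractible_word_rev\<close>).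
\<close>

definition boundary_word :: "'a graph \<Rightarrow> ('a \<Rightarrow> 'c) \<Rightarrow> 'c list \<Rightarrow> bool" where
  "boundary_word G c w \<longleftrightarrow> (\<exists>vs. cyclic_order G vs \<and> w = map c vs)"

definition tricolor :: "('a \<Rightarrow> 'c) \<Rightarrow> 'a set \<Rightarrow> bool" where
  "tricolor c t \<longleftrightarrow> card (c ` t) = 3"

definition contracting_step :: "'c list \<Rightarrow> 'c list \<Rightarrow> bool" where
  "contracting_step xs ys \<longleftrightarrow>
     length xs \<ge> 2 \<and>
     (\<exists>i<length xs.
        \<not> distinct [xs ! ((i + length xs - 1) mod length xs), xs ! i, xs ! ((i + 1) mod length xs)] \<and>
        ys = take i xs @ drop (i + 1) xs)"

definition contractible_word :: "'c list \<Rightarrow> bool" where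
  "contractible_word xs \<longleftrightarrow> (\<exists>x. contracting_step\<^sup>*\<^sup>* xs [x])"

lemma contracting_step_rotate1:
  assumes "contracting_step xs ys"
  shows "\<exists>k. contracting_step (rotate1 xs) (rotate k ys)"
proof -
  let ?n = "length xs"
  obtain i where n: "?n \<ge> 2" and i: "i < ?n"
    and d: "\<not> distinct [xs ! ((i + ?n - 1) mod ?n), xs ! i, xs ! ((i + 1) mod ?n)]"
    and ys: "ys = take i xs @ drop (i + 1) xs"
    using assms unfolding contracting_step_def by blast
  obtain x r where xs: "xs = x # r" using n by (cases xs) auto
  have r: "length r \<ge> 1" using n xs by simp
  define j where "j = (i + ?n - 1) mod ?n"
  have nz: "0 < ?n" using n by linarith
  have j: "j < ?n" using nz unfolding j_def by (rule mod_less_divisor)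
  have e: "rotate1 xs ! m = xs ! ((m + 1) mod ?n)" if "m < ?n" for m
    using nth_rotate1[OF that] by simp
  have "(j + 1) mod ?n = (i + ?n - 1 + 1) mod ?n"
    unfolding j_def by (simp add: mod_Suc_eq)
  moreover have "i + ?n - 1 + 1 = i + ?n" using nz by linarith
  ultimately have j1: "(j + 1) mod ?n = i" using i by simp
  have "((j + ?n - 1) mod ?n + 1) mod ?n = (j + ?n - 1 + 1) mod ?n"
    by (simp add: mod_Suc_eq)
  moreover have "j + ?n - 1 + 1 = j + ?n" using nz by linarith
  ultimately have j2: "((j + ?n - 1) mod ?n + 1) mod ?n = j" using j by simp
  have lt: "(j + ?n - 1) mod ?n < ?n" "(j + 1) mod ?n < ?n"
    using nz by (auto intro: mod_less_divisor)
  have d': "\<not> distinct [rotate1 xs ! ((j + ?n - 1) mod ?n), rotate1 xs ! j, rotate1 xs ! ((j + 1) mod ?n)]"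
    using d[folded j_def] e[OF lt(1), unfolded j2] e[OF i] e[OF j] j1 by (simp only:) simp
  have "\<exists>k. rotate k ys = take j (rotate1 xs) @ drop (j + 1) (rotate1 xs)"
  proof (cases i)
    case 0
    then have "j = length r" using n xs unfolding j_def by simp
    then show ?thesis using 0 ys xs by (intro exI[of _ 0]) simp
  next
    case (Suc m)
    then have "j = m" using i unfolding j_def by simp
    moreover have "m < length r" using i Suc xs by simp
    ultimately show ?thesis using Suc ys xs by (intro exI[of _ 1]) simp
  qed
  then obtain k where "rotate k ys = take j (rotate1 xs) @ drop (j + 1) (rotate1 xs)" ..
  with d' j n show ?thesis unfolding contracting_step_def by (auto simp del: distinct.simps)
qed

lemma contracting_step_rotate:
  "contracting_step xs ys \<Longrightarrow> \<exists>k. contracting_step (rotate m xs) (rotate k ys)"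
proof (induction m)
  case 0
  then show ?case by (intro exI[of _ 0]) simp
next
  case (Suc m)
  then obtain k where "contracting_step (rotate m xs) (rotate k ys)" by blast
  from contracting_step_rotate1[OF this] show ?case by (auto simp: rotate_rotate)
qed

lemma contractible_word_rotateI:
  assumes "contractible_word xs" shows "contractible_word (rotate m xs)"
proof -
  obtain x where "contracting_step\<^sup>*\<^sup>* xs [x]"
    using assms unfolding contractible_word_def by blast
  then have "contracting_step\<^sup>*\<^sup>* (rotate m xs) [x]" for m
  proof (induction arbitrary: m rule: converse_rtranclp_induct)
    case base
    then show ?case by (simp add: rotate_length01)
  next
    case (step y z)
    then show ?case by (meson contracting_step_rotate converse_rtranclp_into_rtranclp)
  qed
  then show ?thesis unfolding contractible_word_def by blast
qed

lemma contractible_word_rotate: "contractible_word (rotate m xs) \<longleftrightarrow> contractible_word xs"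
proof
  assume "contractible_word (rotate m xs)"
  then have "contractible_word (rotate (length xs - m mod length xs) (rotate m xs))"
    by (rule contractible_word_rotateI)
  moreover have "rotate (length xs - m mod length xs) (rotate m xs) = xs"
  proof (cases "xs = []")
    case False
    then have "m mod length xs < length xs" by simp
    moreover have "(length xs - m mod length xs + m) mod length xs
        = (length xs - m mod length xs + m mod length xs) mod length xs"
      by (simp only: mod_add_right_eq)
    ultimately have "(length xs - m mod length xs + m) mod length xs = 0" by simp
    then show ?thesis unfolding rotate_rotate by (rule rotate_id)
  qed simp
  ultimately show "contractible_word xs" by simp
qed (rule contractible_word_rotateI)

lemma contracting_step_rev:
  assumes "contracting_step xs ys"
  shows "contracting_step (rev xs) (rev ys)"
proof -
  let ?n = "length xs"
  obtain i where n: "?n \<ge> 2" and i: "i < ?n"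
    and d: "\<not> distinct [xs ! ((i + ?n - 1) mod ?n), xs ! i, xs ! ((i + 1) mod ?n)]"
    and ys: "ys = take i xs @ drop (i + 1) xs"
    using assms unfolding contracting_step_def by blast
  define j where "j = ?n - 1 - i"
  have j: "j < ?n" using n unfolding j_def by simp
  have e: "rev xs ! j = xs ! i" using i unfolding j_def by (simp add: rev_nth)
  have p: "(m + ?n - 1) mod ?n = (if m = 0 then ?n - 1 else m - 1)" if "m < ?n" for m
    using that by (cases m) simp_all
  have q: "(m + 1) mod ?n = (if m = ?n - 1 then 0 else m + 1)" if "m < ?n" for m
    using that by (cases "m + 1 = ?n") auto
  have e1: "rev xs ! ((j + ?n - 1) mod ?n) = xs ! ((i + 1) mod ?n)"
    unfolding p[OF j] q[OF i] using i n unfolding j_def by (auto simp: rev_nth Suc_diff_Suc)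
  have e2: "rev xs ! ((j + 1) mod ?n) = xs ! ((i + ?n - 1) mod ?n)"
    unfolding p[OF i] q[OF j] using i n unfolding j_def by (auto simp: rev_nth Suc_diff_Suc)
  have "\<not> distinct [rev xs ! ((j + ?n - 1) mod ?n), rev xs ! j, rev xs ! ((j + 1) mod ?n)]"
    unfolding e e1 e2 using d by auto
  moreover have "rev ys = take j (rev xs) @ drop (j + 1) (rev xs)"
    using i unfolding ys j_def by (simp add: take_rev drop_rev Suc_diff_Suc)
  ultimately show ?thesis using j n unfolding contracting_step_def
    by (auto simp del: distinct.simps)
qed

lemma contractible_word_rev: "contractible_word (rev xs) \<longleftrightarrow> contractible_word xs"
proof -
  have "contracting_step\<^sup>*\<^sup>* (rev xs) [x]" if "contracting_step\<^sup>*\<^sup>* xs [x]" for xs and x :: 'a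
    using that
    by (induction rule: converse_rtranclp_induct)
      (auto intro: converse_rtranclp_into_rtranclp contracting_step_rev)
  from this[of xs] this[of "rev xs"] show ?thesis unfolding contractible_word_def by auto
qed

end

theory Submission
  imports Defs
begin

text \<open>
  If no triangle is tricolor, the coloring maps the disk to the complete graph on the colors, so
  the boundary word spells a null-homotopic closed walk in that graph. We contract a
  parametrization of the boundary inside the disk along a fine grid, and color each grid point by
  a vertex at which the barycentric coordinate of its image is at least \<open>1/3\<close>. By uniform
  continuity the vertices chosen at the corners of a grid cell lie in one triangle, so a cell
  carries at most two colors, and the lift of a walk to the universal cover of the complete graph
  keeps its end point when the walk is pushed across the cell. Hence the lift of the boundary
  word is closed. Contracting steps preserve this property, while the lift of a word of length
  at least two without contracting steps is a geodesic in a tree, hence not closed.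
\<close>

section \<open>Closed words\<close>

text \<open>
  The vertices of the universal cover are the walks without backtracking, stored with the end
  point first; \<open>push s x\<close> is the neighbor of \<open>s\<close> that lies over \<open>x\<close> (or \<open>s\<close> itself).
\<close>

fun push :: "'c list \<Rightarrow> 'c \<Rightarrow> 'c list" where
  "push [] x = [x]"
| "push [y] x = (if x = y then [y] else [x, y])"
| "push (y # z # r) x = (if x = y then y # z # r else if x = z then z # r else x # y # z # r)"

fun nonbacktracking :: "'c list \<Rightarrow> bool" where
  "nonbacktracking (x # y # z # r) \<longleftrightarrow> x \<noteq> z \<and> nonbacktracking (y # z # r)"
| "nonbacktracking [] \<longleftrightarrow> True"
| "nonbacktracking [x] \<longleftrightarrow> True"
| "nonbacktracking [x, y] \<longleftrightarrow> True"

definition stack :: "'c list \<Rightarrow> bool" where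
  "stack s \<longleftrightarrow> s \<noteq> [] \<and> nonbacktracking s"

lemma hd_push [simp]: "hd (push s x) = x"
  by (cases "(s, x)" rule: push.cases) auto

lemma push_hd: "s \<noteq> [] \<Longrightarrow> push s (hd s) = s"
  by (cases "(s, hd s)" rule: push.cases) auto

lemma push_nonempty [simp]: "push s x \<noteq> []"
  by (cases "(s, x)" rule: push.cases) auto

lemma push_push_same [simp]: "push (push s x) x = push s x"
  using push_hd[of "push s x"] by simp

lemma stack_push [simp]: "stack s \<Longrightarrow> stack (push s x)"
  unfolding stack_def
  by (cases s rule: nonbacktracking.cases; cases "(s, x)" rule: push.cases) auto

text \<open>A step along a tree edge is undone by the step back: if the first step deletes the top
  letter, \<open>nonbacktracking\<close> keeps the second from deleting again, so the letter is
  restored.\<close>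

lemma push_push_hd: "stack s \<Longrightarrow> push (push s x) (hd s) = s"
  unfolding stack_def by (cases s rule: nonbacktracking.cases) auto

text \<open>With at most two colors the lift stays on one edge of the tree, so the detour through
  \<open>x\<close> cancels. This is the homotopy move across a triangle.\<close>

lemma push_push_not_distinct:
  assumes "stack s" "\<not> distinct [hd s, x, y]"
  shows "push (push s x) y = push s y"
  using assms push_push_hd[OF assms(1)] push_hd[of s] by (auto simp: stack_def)

lemma stack_foldl_push [simp]: "stack s \<Longrightarrow> stack (foldl push s w)"
  by (induction w arbitrary: s) auto

lemma hd_foldl_push: "w \<noteq> [] \<Longrightarrow> hd (foldl push s w) = last w"
  by (induction w rule: rev_induct) auto

lemma foldl_push_replicate: "m > 0 \<Longrightarrow> foldl push s (replicate m x) = push s x"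
proof (induction m)
  case (Suc m)
  then show ?case by (cases "m = 0") (simp_all flip: replicate_append_same)
qed simp

lemma push_inject:
  assumes "stack s" "stack t" "hd s = hd t" "push s x = push t x"
  shows "s = t"
  using assms push_push_hd by metis

text \<open>Lifts can be traced backwards: both lie over the same letter at every moment, so
  \<open>push_inject\<close> cancels one letter at a time.\<close>

lemma foldl_push_inject:
  assumes "stack s" "stack t" "hd s = hd t" "foldl push s w = foldl push t w"
  shows "s = t"
  using assms
proof (induction w arbitrary: s t)
  case (Cons x w)
  have "push s x = push t x"
    using Cons.IH[of "push s x" "push t x"] Cons.prems by simp
  then show ?case using Cons.prems(1-3) push_inject[of s t x] by simp
qed simp

text \<open>Null-homotopy of the closed walk based at \<open>last w\<close>. Ranging over all lifts
  \<open>s\<close> of the base point lets the base point move.\<close>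

definition closed_word :: "'c list \<Rightarrow> bool" where
  "closed_word w \<longleftrightarrow> (\<forall>s. stack s \<longrightarrow> hd s = last w \<longrightarrow> foldl push s w = s)"

text \<open>Conjugation by the path \<open>v\<close>: the loop closes at the end of the lift of
  \<open>v\<close>, and injectivity along \<open>v\<close> carries this back to
  \<open>s\<close>.\<close>

lemma closed_word_append_commute:
  assumes "closed_word (u @ v)"
  shows "closed_word (v @ u)"
proof (cases "u = [] \<or> v = []")
  case False
  have "foldl push s (v @ u) = s" if s: "stack s" "hd s = last (v @ u)" for s
  proof -
    define s' where "s' = foldl push s v"
    have s': "stack s'" "hd s' = last (u @ v)"
      using s False by (auto simp: s'_def hd_foldl_push)
    then have "foldl push s' (u @ v) = s'" using assms by (simp add: closed_word_def)
    then have "foldl push (foldl push s' u) v = foldl push s v" by (simp add: s'_def)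
    then have "foldl push s' u = s"
      using s s' False by (intro foldl_push_inject[of _ s v]) (auto simp: hd_foldl_push)
    then show ?thesis by (simp add: s'_def)
  qed
  then show ?thesis by (simp add: closed_word_def)
next
  case True
  then show ?thesis using assms by (elim disjE) simp_all
qed

lemma closed_word_delete_hd:
  assumes "closed_word (x # r)" "r \<noteq> []" "\<not> distinct [last r, x, hd r]"
  shows "closed_word r"
proof -
  have "foldl push s r = s" if s: "stack s" "hd s = last r" for s
  proof -
    obtain y q where r: "r = y # q" using assms(2) by (cases r) auto
    have "push (push s x) y = push s y"
      using s assms(3) r by (intro push_push_not_distinct) auto
    then have "foldl push s (x # r) = foldl push s r" by (simp add: r)
    moreover have "foldl push s (x # r) = s" using assms(1,2) s by (simp add: closed_word_def)
    ultimately show ?thesis by simp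
  qed
  then show ?thesis by (simp add: closed_word_def)
qed

lemma closed_word_contracting_step:
  assumes "closed_word w" "contracting_step w w'"
  shows "closed_word w'"
proof -
  let ?n = "length w"
  obtain i where n: "?n \<ge> 2" and i: "i < ?n"
    and d: "\<not> distinct [w ! ((i + ?n - 1) mod ?n), w ! i, w ! ((i + 1) mod ?n)]"
    and w': "w' = take i w @ drop (i + 1) w"
    using assms(2) unfolding contracting_step_def by blast
  \<comment> \<open>Rotation brings the deleted letter to the front, so its cyclic neighbors become
    the last and first letters of \<open>?r\<close>.\<close>
  let ?r = "drop (i + 1) w @ take i w"
  have "w = take i w @ w ! i # drop (i + 1) w" using id_take_nth_drop[OF i] by simp
  then have "closed_word ((w ! i # drop (i + 1) w) @ take i w)"
    using closed_word_append_commute assms(1) by metis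
  then have cl: "closed_word (w ! i # ?r)" by simp
  have r: "?r \<noteq> []" using n i by auto
  have hd: "hd ?r = w ! ((i + 1) mod ?n)"
  proof (cases "i + 1 < ?n")
    case True
    then show ?thesis by (simp add: hd_append hd_drop_conv_nth)
  next
    case False
    then have "i + 1 = ?n" using i by simp
    moreover from this have "0 < i" using n by linarith
    moreover have "w \<noteq> []" using n by auto
    ultimately show ?thesis by (simp add: hd_conv_nth)
  qed
  have last: "last ?r = w ! ((i + ?n - 1) mod ?n)"
  proof (cases i)
    case 0
    moreover have "w \<noteq> []" using n by auto
    ultimately show ?thesis using n by (simp add: last_conv_nth[of w])
  next
    case (Suc k)
    then have "(i + ?n - 1) mod ?n = k" using i by simp
    moreover have "k < ?n" using Suc i by simp
    ultimately show ?thesis using Suc by (simp add: take_Suc_conv_app_nth)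
  qed
  have "closed_word ?r"
    by (rule closed_word_delete_hd[OF cl r]) (use d in \<open>simp only: hd last not_False_eq_True\<close>)
  then show ?thesis unfolding w' by (rule closed_word_append_commute)
qed

text \<open>Each letter differs from its two cyclic predecessors, so every push extends the stack.
  The start \<open>[last w]\<close> supplies the predecessor that precedes the first letter.\<close>

lemma foldl_push_geodesic:
  assumes n: "length w \<ge> 2"
    and d: "\<And>i. i < length w \<Longrightarrow>
      distinct [w ! ((i + length w - 1) mod length w), w ! i, w ! ((i + 1) mod length w)]"
    and "k \<le> length w"
  shows "foldl push [last w] (take k w) = rev (take k w) @ [last w]"
  using assms(3)
proof (induction k)
  case (Suc k)
  let ?n = "length w"
  have k: "k < ?n" using Suc.prems by simp
  have l: "last w = w ! (?n - 1)" using n by (intro last_conv_nth) auto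
  have "foldl push [last w] (take (Suc k) w) = push (rev (take k w) @ [last w]) (w ! k)"
    using Suc k by (simp add: take_Suc_conv_app_nth)
  also have "\<dots> = w ! k # rev (take k w) @ [last w]"
  proof (cases k)
    case 0
    moreover have "0 < ?n" using n by linarith
    ultimately show ?thesis using d[of 0] l by auto
  next
    case (Suc m)
    note km = Suc
    have m: "(m + 1) mod ?n = k" "m < ?n" using k km by simp_all
    have dm: "w ! k \<noteq> w ! m" "w ! k \<noteq> w ! ((m + ?n - 1) mod ?n)"
      using d[OF m(2)] m by auto
    show ?thesis
    proof (cases m)
      case 0
      moreover have "w \<noteq> []" using k by auto
      ultimately show ?thesis using km dm l by (simp add: take_Suc_conv_app_nth)
    next
      case (Suc p)
      then have "(m + ?n - 1) mod ?n = p" using m by simp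
      then show ?thesis using km dm Suc k by (simp add: take_Suc_conv_app_nth)
    qed
  qed
  finally show ?case using k by (simp add: take_Suc_conv_app_nth)
qed simp

text \<open>A contracting step shortens the word and keeps it closed. Without one, a word of length
  at least two would lift to a geodesic with distinct end points.\<close>

lemma closed_word_contractible:
  assumes "closed_word w" "w \<noteq> []"
  shows "contractible_word w"
  using assms
proof (induction "length w" arbitrary: w rule: less_induct)
  case less
  show ?case
  proof (cases "\<exists>w'. contracting_step w w'")
    case True
    then obtain w' where w': "contracting_step w w'" ..
    then have "length w' < length w" "w' \<noteq> []" by (auto simp: contracting_step_def)
    then have "contractible_word w'"
      using less closed_word_contracting_step w' by blast
    then show ?thesis
      using w' unfolding contractible_word_def by (meson converse_rtranclp_into_rtranclp)
  next
    case False
    have "length w < 2"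
    proof (rule ccontr)
      assume n: "\<not> length w < 2"
      then have "distinct [w ! ((i + length w - 1) mod length w), w ! i, w ! ((i + 1) mod length w)]"
        if "i < length w" for i
        using False that unfolding contracting_step_def by (meson not_less)
      then have "foldl push [last w] (take (length w) w) = rev (take (length w) w) @ [last w]"
        using n by (intro foldl_push_geodesic) auto
      moreover have "foldl push [last w] w = [last w]"
        using less(2) by (simp add: closed_word_def stack_def)
      ultimately show False using less.prems(2) by simp
    qed
    then obtain x where "w = [x]" using less.prems(2) by (cases w) auto
    then show ?thesis unfolding contractible_word_def by blast
  qed
qed

text \<open>Repeated letters do not move the lift. This passes from a fine grid row to the boundary
  word.\<close>

lemma foldl_push_dilate:
  assumes "m > 0"
  shows "foldl push s (map (\<lambda>j. h (j div m)) [0..<n * m]) = foldl push s (map h [0..<n])"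
proof (induction n)
  case (Suc n)
  have "map (\<lambda>j. h (j div m)) [n * m..<n * m + m] = replicate m (h n)"
    by (rule nth_equalityI) auto
  moreover have "[0..<Suc n * m] = [0..<n * m] @ [n * m..<n * m + m]"
    by (metis add.commute le0 mult_Suc upt_add_eq_append)
  ultimately show ?case using Suc assms by (simp add: foldl_push_replicate)
qed simp

section \<open>Colored grids\<close>

text \<open>The diagonal from \<open>a j\<close> to \<open>b (Suc j)\<close> cuts each cell in two.
  Crossing one triangle drops \<open>b j\<close>, crossing the other inserts
  \<open>a (Suc j)\<close>.\<close>

lemma foldl_push_adjacent_rows:
  assumes s: "stack s" "hd s = a 0"
    and "\<And>j. j < n \<Longrightarrow> \<not> distinct [a j, a (Suc j), b (Suc j)]"
    and "\<And>j. j < n \<Longrightarrow> \<not> distinct [a j, b j, b (Suc j)]"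
    and "k \<le> n"
  shows "foldl push (push s (b 0)) (map b [1..<Suc k]) = push (foldl push s (map a [1..<Suc k])) (b k)"
  using assms(5)
proof (induction k)
  case (Suc k)
  let ?S = "foldl push s (map a [1..<Suc k])"
  have S: "stack ?S" using s by simp
  have h: "hd ?S = a k"
    using s by (cases k) (simp_all add: hd_foldl_push)
  have "foldl push (push s (b 0)) (map b [1..<Suc (Suc k)]) = push (push ?S (b k)) (b (Suc k))"
    using Suc by simp
  also have "\<dots> = push ?S (b (Suc k))"
    using Suc.prems assms(4)[of k] S h by (intro push_push_not_distinct) auto
  also have "\<dots> = push (push ?S (a (Suc k))) (b (Suc k))"
    using Suc.prems assms(3)[of k] S h by (intro push_push_not_distinct[symmetric]) auto
  finally show ?case by simp
qed simp

text \<open>Periodicity makes the rungs at both ends equal, so the two row lifts differ by a common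
  push to \<open>b 0\<close>, which \<open>push_inject\<close> cancels.\<close>

lemma closed_word_adjacent_rows:
  assumes "closed_word (map b [1..<Suc n])"
    and "n > 0" "a n = a 0" "b n = b 0"
    and "\<And>j. j < n \<Longrightarrow> \<not> distinct [a j, a (Suc j), b (Suc j)]"
    and "\<And>j. j < n \<Longrightarrow> \<not> distinct [a j, b j, b (Suc j)]"
  shows "closed_word (map a [1..<Suc n])"
proof -
  have "foldl push s (map a [1..<Suc n]) = s" if s: "stack s" "hd s = last (map a [1..<Suc n])" for s
  proof -
    have h: "hd s = a 0" using s assms(2,3) by simp
    have "push s (b 0) = foldl push (push s (b 0)) (map b [1..<Suc n])"
      using assms(1,2,4) s by (simp add: closed_word_def)
    also have "\<dots> = push (foldl push s (map a [1..<Suc n])) (b n)"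
      using s(1) h assms(5,6) by (intro foldl_push_adjacent_rows[where n = n]) auto
    finally have "push (foldl push s (map a [1..<Suc n])) (b n) = push s (b n)"
      using assms(4) by simp
    then show ?thesis
      using s assms(2) by (intro push_inject[of _ s "b n"]) (simp_all add: hd_foldl_push)
  qed
  then show ?thesis by (simp add: closed_word_def)
qed

text \<open>The induction runs from the constant last row, whose lift never moves, back to row
  0.\<close>

lemma closed_word_grid:
  fixes A :: "nat \<Rightarrow> nat \<Rightarrow> 'c"
  assumes "n > 0"
    and "\<And>i. i \<le> m \<Longrightarrow> A i n = A i 0"
    and "\<And>i j. i < m \<Longrightarrow> j < n \<Longrightarrow> \<not> distinct [A i j, A i (Suc j), A (Suc i) (Suc j)]"
    and "\<And>i j. i < m \<Longrightarrow> j < n \<Longrightarrow> \<not> distinct [A i j, A (Suc i) j, A (Suc i) (Suc j)]"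
    and "\<And>j. j \<le> n \<Longrightarrow> A m j = x"
  shows "closed_word (map (A 0) [1..<Suc n])"
proof -
  have "closed_word (map (A i) [1..<Suc n])" if "i \<le> m" for i
    using that
  proof (induction rule: inc_induct)
    case base
    have "map (A m) [1..<Suc n] = replicate n x"
      by (rule nth_equalityI) (use assms(5) in \<open>auto simp del: upt_Suc\<close>)
    then show ?case
      using assms(1) by (auto simp: closed_word_def foldl_push_replicate stack_def push_hd simp del: upt_Suc)
  next
    case (step i)
    show ?case
    proof (rule closed_word_adjacent_rows)
      show "A i n = A i 0" "A (Suc i) n = A (Suc i) 0" using assms(2) step by simp_all
    qed (use assms step in blast)+
  qed
  then show ?thesis by simp
qed

section \<open>Null-homotopic loops in the realization\<close>

lemma realization_support_subset:
  assumes "p \<in> realization (generated_complex F)"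
  obtains t where "t \<in> F" "{v. p v \<noteq> 0} \<subseteq> t"
  using assms unfolding realization_def generated_complex_def by auto

text \<open>At most three coordinates are nonzero and they sum to one, so they cannot all lie below
  \<open>1/3\<close>.\<close>

lemma realization_large_coordinate:
  assumes "p \<in> realization (generated_complex T)" "\<And>t. t \<in> T \<Longrightarrow> card t = 3"
  obtains v where "p v \<ge> 1/3"
proof -
  obtain t where t: "t \<in> T" "{v. p v \<noteq> 0} \<subseteq> t"
    using assms(1) by (rule realization_support_subset)
  let ?S = "{v. p v \<noteq> 0}"
  have fin: "finite t" using assms(2)[OF t(1)] card.infinite by fastforce
  have sum: "(\<Sum>v\<in>?S. p v) = 1" using assms(1) by (simp add: realization_def)
  have "\<exists>v. p v \<ge> 1/3"
  proof (rule ccontr)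
    assume "\<nexists>v. p v \<ge> 1/3"
    then have less: "p v < 1/3" for v by (simp add: not_le)
    have "?S \<noteq> {}" using sum by (metis sum.empty zero_neq_one)
    then have "(\<Sum>v\<in>?S. p v) < real (card ?S) * (1/3)"
      using less fin t(2) finite_subset by (intro sum_bounded_above_strict) (auto simp: card_gt_0_iff)
    moreover have "card ?S \<le> 3" using card_mono[OF fin t(2)] assms(2)[OF t(1)] by simp
    ultimately show False using sum by simp
  qed
  then show thesis using that by blast
qed

lemma realization_segment:
  assumes "{a, b} \<in> E" "a \<noteq> b" "0 \<le> r" "r \<le> 1"
  shows "(\<lambda>v. (if a = v then 1 - r else 0) + (if b = v then r else 0)) \<in> realization (generated_complex E)"
    (is "?p \<in> _")
proof -
  \<comment> \<open>For \<open>r = 0\<close> or \<open>r = 1\<close> the support is a single end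
    point, hence only an inclusion; it is still a face.\<close>
  have sub: "{v. ?p v \<noteq> 0} \<subseteq> {a, b}" by auto
  have "(\<Sum>v | ?p v \<noteq> 0. ?p v) = (\<Sum>v\<in>{a, b}. ?p v)"
    using sub by (intro sum.mono_neutral_left) auto
  also have "\<dots> = 1" using assms(2) by simp
  finally have "(\<Sum>v | ?p v \<noteq> 0. ?p v) = 1" .
  moreover from this have "{v. ?p v \<noteq> 0} \<noteq> {}" by (metis (no_types, lifting) sum.empty zero_neq_one)
  ultimately show ?thesis
    using sub assms unfolding realization_def generated_complex_def by auto
qed

section \<open>The boundary loop as a piecewise linear path\<close>

definition hat :: "real \<Rightarrow> real" where
  "hat x = max 0 (1 - \<bar>x\<bar>)"

text \<open>The piecewise linear path through the vertices \<open>u 0, \<dots>, u (Suc n)\<close> at the times \<open>0, \<dots>, n + 1\<close>.\<close>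

definition edge_path :: "(nat \<Rightarrow> 'a) \<Rightarrow> nat \<Rightarrow> real \<Rightarrow> 'a \<Rightarrow> real" where
  "edge_path u n t = (\<lambda>v. \<Sum>k\<le>Suc n. if u k = v then hat (t - real k) else 0)"

lemma continuous_on_edge_path: "continuous_on S (edge_path u n)"
proof (rule continuous_on_coordinatewise_then_product)
  fix v
  have "continuous_on S (\<lambda>t. if u k = v then hat (t - real k) else 0)" for k
    unfolding hat_def by (cases "u k = v"; simp; intro continuous_intros)
  then show "continuous_on S (\<lambda>t. edge_path u n t v)"
    unfolding edge_path_def by (intro continuous_on_sum) auto
qed

lemma edge_path_segment:
  assumes "k \<le> n" "0 \<le> r" "r \<le> 1"
  shows "edge_path u n (real k + r) =
    (\<lambda>v. (if u k = v then 1 - r else 0) + (if u (Suc k) = v then r else 0))"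
proof
  fix v
  have "edge_path u n (real k + r) v =
      (\<Sum>i\<in>{k, Suc k}. if u i = v then hat (real k + r - real i) else 0)"
    unfolding edge_path_def
  proof (rule sum.mono_neutral_right)
    show "\<forall>i\<in>{..Suc n} - {k, Suc k}. (if u i = v then hat (real k + r - real i) else 0) = 0"
    proof
      fix i assume "i \<in> {..Suc n} - {k, Suc k}"
      then have "i + 1 \<le> k \<or> k + 2 \<le> i" by auto
      then have "real i + 1 \<le> real k \<or> real k + 2 \<le> real i" by linarith
      then show "(if u i = v then hat (real k + r - real i) else 0) = 0"
        using assms by (auto simp: hat_def)
    qed
  qed (use assms in auto)
  then show "edge_path u n (real k + r) v =
      (if u k = v then 1 - r else 0) + (if u (Suc k) = v then r else 0)"
    using assms by (auto simp: hat_def)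
qed

lemma edge_path_in_realization:
  assumes "\<And>k. k \<le> n \<Longrightarrow> u k \<noteq> u (Suc k) \<and> {u k, u (Suc k)} \<in> E"
    and "0 \<le> t" "t < real (Suc n)"
  shows "edge_path u n t \<in> realization (generated_complex E)"
proof -
  define k where "k = nat \<lfloor>t\<rfloor>"
  define r where "r = t - real k"
  have "real k \<le> t" "t < real k + 1" using assms(2) unfolding k_def by linarith+
  then have r: "0 \<le> r" "r \<le> 1" and k: "k \<le> n" using assms(3) by (auto simp: r_def)
  have "edge_path u n (real k + r) \<in> realization (generated_complex E)"
    using assms(1) k r by (auto simp: edge_path_segment[OF k r] intro!: realization_segment)
  then show ?thesis by (simp add: r_def)
qed

text \<open>The tent at time \<open>k\<close> alone contributes \<open>1/2\<close>; further visits
  to the same vertex only add. This makes \<open>u k\<close> a legitimate choice in row 0 of the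
  grid.\<close>

lemma edge_path_near_vertex:
  assumes "k \<le> Suc n" "\<bar>t - real k\<bar> \<le> 1/2"
  shows "edge_path u n t (u k) \<ge> 1/2"
proof -
  have "1/2 \<le> hat (t - real k)" using assms(2) by (simp add: hat_def)
  also have "\<dots> = (\<Sum>i\<in>{k}. if u i = u k then hat (t - real i) else 0)" by simp
  also have "\<dots> \<le> edge_path u n t (u k)"
    unfolding edge_path_def using assms(1) by (intro sum_mono2) (auto simp: hat_def)
  finally show ?thesis .
qed

section \<open>Coloring a fine grid over a homotopy\<close>

lemma uniform_mesh:
  fixes H :: "real \<times> real \<Rightarrow> 'a \<Rightarrow> real"
  assumes "continuous_on K H" "compact K" "finite V" "e > 0"
  obtains d where "d > 0"
    "\<And>x y v. x \<in> K \<Longrightarrow> y \<in> K \<Longrightarrow> dist x y < d \<Longrightarrow> v \<in> V \<Longrightarrow> \<bar>H x v - H y v\<bar> < e"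
proof -
  have "\<exists>d>0. \<forall>v\<in>V. \<forall>x\<in>K. \<forall>y\<in>K. dist x y < d \<longrightarrow> \<bar>H x v - H y v\<bar> < e"
    using assms(3)
  proof (induction V rule: finite_induct)
    case empty
    then show ?case by (intro exI[of _ 1]) simp
  next
    case (insert v V)
    have "uniformly_continuous_on K (\<lambda>x. H x v)"
      by (rule compact_uniformly_continuous[OF continuous_on_product_then_coordinatewise[OF assms(1)] assms(2)])
    then obtain d where d: "d > 0" "\<And>x y. x \<in> K \<Longrightarrow> y \<in> K \<Longrightarrow> dist x y < d \<Longrightarrow> \<bar>H x v - H y v\<bar> < e"
      using assms(4) unfolding uniformly_continuous_on_def dist_real_def by metis
    obtain d' where d': "d' > 0"
      "\<And>v x y. v \<in> V \<Longrightarrow> x \<in> K \<Longrightarrow> y \<in> K \<Longrightarrow> dist x y < d' \<Longrightarrow> \<bar>H x v - H y v\<bar> < e"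
      using insert.IH by metis
    have "\<bar>H x w - H y w\<bar> < e" if "w \<in> insert v V" "x \<in> K" "y \<in> K" "dist x y < min d d'" for w x y
      using that d(2)[of x y] d'(2)[of w x y] by (cases "w = v") simp_all
    moreover have "min d d' > 0" using d(1) d'(1) by simp
    ultimately show ?case by blast
  qed
  then show thesis using that by blast
qed

text \<open>
  The grid starts at time \<open>1/2\<close>, so that each letter of the boundary word
  is repeated \<open>M\<close> times in row 0 without being cut at the seam.
\<close>

lemma closed_word_null_homotopic:
  fixes c :: "'a \<Rightarrow> 'c" and H :: "real \<times> real \<Rightarrow> 'a \<Rightarrow> real" and n :: nat
  defines "K \<equiv> {0..1} \<times> {1/2..real n + 1/2}"
  assumes T: "finite T" "\<And>t. t \<in> T \<Longrightarrow> card t = 3" "\<And>t. t \<in> T \<Longrightarrow> \<not> tricolor c t"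
    and n: "n > 0" and per: "u n = u 0"
    and H: "continuous_on K H" "H ` K \<subseteq> realization (generated_complex T)"
    and H0: "\<And>t. t \<in> {1/2..real n + 1/2} \<Longrightarrow> H (0, t) = edge_path u n t"
    and H1: "\<And>t. t \<in> {1/2..real n + 1/2} \<Longrightarrow> H (1, t) = q"
    and seam: "\<And>s. s \<in> {0..1} \<Longrightarrow> H (s, real n + 1/2) = H (s, 1/2)"
  shows "closed_word (map (\<lambda>k. c (u (Suc k))) [0..<n])"
proof -
  have "finite (\<Union>T)" using T(1,2) card.infinite by (intro finite_Union) fastforce+
  moreover have "compact K" unfolding K_def by (intro compact_Times) auto
  ultimately obtain d where d: "d > 0"
    "\<And>x y v. x \<in> K \<Longrightarrow> y \<in> K \<Longrightarrow> dist x y < d \<Longrightarrow> v \<in> \<Union>T \<Longrightarrow> \<bar>H x v - H y v\<bar> < 1/3"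
    using uniform_mesh[OF H(1), of "\<Union>T" "1/3"] by auto
  \<comment> \<open>Grid points of one cell lie at distance at most \<open>2 / M\<close>, which has
    to be below \<open>d\<close>.\<close>
  obtain M0 :: nat where M0: "real M0 > 2 / d" using reals_Archimedean2 by blast
  define M where "M = Suc M0"
  have M: "M > 0" "2 / real M < d"
    using M0 d(1) by (auto simp: M_def field_simps)
  have last_div: "(n * M - 1) div M = n - 1"
  proof -
    have "n * M - 1 = (n - 1) * M + M0" using n by (cases n) (simp_all add: M_def)
    then show ?thesis by (simp add: M_def del: mult_Suc_right)
  qed
  define z where "z i j = (real i / real M, 1/2 + real j / real M)" for i j :: nat
  define pick where "pick p = (SOME v. p v \<ge> 1/3)" for p :: "'a \<Rightarrow> real"
  \<comment> \<open>Row 0 is prescribed so that it spells the boundary word. At the tied times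
    \<open>k + 1/2\<close> the shift \<open>j - 1\<close> selects the earlier vertex, and
    \<open>j = 0\<close> gets \<open>u 0\<close>, matching \<open>u n\<close> at the seam.\<close>
  define a where "a i j = (if i = 0 then u (if j = 0 then 0 else Suc ((j - 1) div M)) else pick (H (z i j)))"
    for i j :: nat
  define A where "A i j = c (a i j)" for i j
  have le_div: "real j / real M \<le> real n" if "j \<le> n * M" for j
    using that M(1) by (simp add: pos_divide_le_eq flip: of_nat_mult)
  have zK: "z i j \<in> K" if "i \<le> M" "j \<le> n * M" for i j
    using that le_div[of j] M(1) by (auto simp: z_def K_def)
  have large0: "H (z 0 j) (a 0 j) \<ge> 1/3" if j: "j \<le> n * M" for j
  proof -
    have t: "1/2 + real j / real M \<in> {1/2..real n + 1/2}" using le_div[OF j] by simp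
    define k where "k = (if j = 0 then 0 else Suc ((j - 1) div M))"
    have k: "k \<le> Suc n \<and> \<bar>1/2 + real j / real M - real k\<bar> \<le> 1/2"
    proof (cases j)
      case 0
      then show ?thesis by (simp add: k_def)
    next
      case (Suc i)
      define b where "b = i div M"
      have "b * M \<le> i" "i < Suc b * M"
        using M(1) by (auto simp: b_def dividend_less_div_times[of M i])
      then have "b * M \<le> j" "j \<le> Suc b * M" using Suc by auto
      then have "real b * real M \<le> real j" "real j \<le> real (Suc b) * real M"
        unfolding of_nat_mult[symmetric] of_nat_le_iff by simp_all
      then have b: "real b \<le> real j / real M" "real j / real M \<le> real (Suc b)"
        using M(1) by (simp_all add: pos_le_divide_eq pos_divide_le_eq)
      have "k = Suc b" using Suc by (simp add: k_def b_def)
      moreover have "b \<le> n" using b(1) le_div[OF j] by linarith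
      moreover have "\<bar>1/2 + real j / real M - real (Suc b)\<bar> \<le> 1/2" using b by linarith
      ultimately show ?thesis by simp
    qed
    have "edge_path u n (1/2 + real j / real M) (u k) \<ge> 1/2"
      using k by (intro edge_path_near_vertex) auto
    moreover have "H (z 0 j) = edge_path u n (1/2 + real j / real M)"
      using H0[OF t] by (simp add: z_def)
    moreover have "a 0 j = u k" by (simp add: a_def k_def)
    ultimately show ?thesis by simp
  qed
  have large: "H (z i j) (a i j) \<ge> 1/3" if "i \<le> M" "j \<le> n * M" for i j
  proof (cases "i = 0")
    case True
    then show ?thesis using large0 that by simp
  next
    case False
    have "H (z i j) \<in> realization (generated_complex T)" using H(2) zK[OF that] by blast
    then obtain v where "H (z i j) v \<ge> 1/3" using T(2) by (rule realization_large_coordinate)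
    then have "H (z i j) (pick (H (z i j))) \<ge> 1/3" unfolding pick_def by (rule someI)
    then show ?thesis using False by (simp add: a_def)
  qed
  have vertex: "a i j \<in> \<Union>T" if ij: "i \<le> M" "j \<le> n * M" for i j
  proof -
    have "H (z i j) \<in> realization (generated_complex T)" using H(2) zK[OF ij] by blast
    then obtain t where "t \<in> T" "{v. H (z i j) v \<noteq> 0} \<subseteq> t" by (rule realization_support_subset)
    moreover have "H (z i j) (a i j) \<noteq> 0" using large[OF ij] by linarith
    ultimately show ?thesis by blast
  qed
  \<comment> \<open>A coordinate of at least \<open>1/3\<close> at \<open>z i' j'\<close> changes by
    less than \<open>1/3\<close> over the mesh, so it stays positive at the base corner
    \<open>z i j\<close>.\<close>
  have near: "H (z i j) (a i' j') > 0"
    if "i' \<le> M" "j' \<le> n * M" "i \<le> M" "j \<le> n * M" "i \<le> i'" "i' \<le> Suc i" "j \<le> j'" "j' \<le> Suc j" for i j i' j'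
  proof -
    have "dist (z i j) (z i' j') \<le> \<bar>real i / real M - real i' / real M\<bar> + \<bar>real j / real M - real j' / real M\<bar>"
      unfolding z_def dist_Pair_Pair dist_real_def
      by (rule order_trans[OF sqrt_sum_squares_le_sum_abs]) simp
    also have "\<dots> = (\<bar>real i - real i'\<bar> + \<bar>real j - real j'\<bar>) / real M"
      using M(1) by (simp add: add_divide_distrib flip: diff_divide_distrib)
    also have "\<dots> \<le> 2 / real M"
      using that by (intro divide_right_mono) auto
    finally have "dist (z i j) (z i' j') < d" using M(2) by simp
    then have "\<bar>H (z i j) (a i' j') - H (z i' j') (a i' j')\<bar> < 1/3"
      using that by (intro d(2) zK vertex) auto
    then show ?thesis using large[of i' j'] that by linarith
  qed
  \<comment> \<open>The vertices chosen at the corners all have positive coordinate at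
    \<open>z i j\<close>, hence lie in one triangle. Letting \<open>(i1, j1)\<close> vary treats
    both halves of the cell at once.\<close>
  have cell: "\<not> distinct [A i j, A i1 j1, A (Suc i) (Suc j)]"
    if ij: "i < M" "j < n * M" and i1: "i1 \<in> {i, Suc i}" "j1 \<in> {j, Suc j}" for i j i1 j1
  proof
    assume dist: "distinct [A i j, A i1 j1, A (Suc i) (Suc j)]"
    let ?S = "{a i j, a i1 j1, a (Suc i) (Suc j)}"
    have "H (z i j) \<in> realization (generated_complex T)" using H(2) zK[of i j] ij by auto
    then obtain t where t: "t \<in> T" "{v. H (z i j) v \<noteq> 0} \<subseteq> t" by (rule realization_support_subset)
    have "H (z i j) (a i j) > 0" "H (z i j) (a i1 j1) > 0" "H (z i j) (a (Suc i) (Suc j)) > 0"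
      using ij i1 by (auto intro!: near)
    then have "?S \<subseteq> {v. H (z i j) v \<noteq> 0}" by simp
    then have "?S \<subseteq> t" using t(2) by (rule subset_trans)
    moreover have fin: "finite t" using T(2)[OF t(1)] card.infinite by fastforce
    ultimately have "card (c ` ?S) \<le> card (c ` t)" by (intro card_mono image_mono finite_imageI)
    moreover have "card (c ` ?S) = 3" using dist by (simp add: A_def)
    moreover have "card (c ` t) \<le> 3" using card_image_le[OF fin, of c] T(2)[OF t(1)] by simp
    ultimately show False using T(3)[OF t(1)] by (simp add: tricolor_def)
  qed
  have "closed_word (map (A 0) [1..<Suc (n * M)])"
  proof (rule closed_word_grid)
    show "n * M > 0" using n M(1) by simp
    show "A i (n * M) = A i 0" if "i \<le> M" for i
    proof (cases "i = 0")
      case True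
      then show ?thesis using n M(1) per last_div by (simp add: A_def a_def)
    next
      case False
      \<comment> \<open>\<open>pick\<close> depends only on the point, so both sides of the seam get
        the same vertex.\<close>
      have "H (z i (n * M)) = H (z i 0)"
        using seam[of "real i / real M"] that M(1) by (simp add: z_def add.commute)
      then show ?thesis using False by (simp add: A_def a_def)
    qed
    show "\<not> distinct [A i j, A i (Suc j), A (Suc i) (Suc j)]" if "i < M" "j < n * M" for i j
      using that by (intro cell) auto
    show "\<not> distinct [A i j, A (Suc i) j, A (Suc i) (Suc j)]" if "i < M" "j < n * M" for i j
      using that by (intro cell) auto
    show "A M j = c (pick q)" if "j \<le> n * M" for j
      using H1[of "1/2 + real j / real M"] le_div[OF that] M(1) by (simp add: A_def a_def z_def)
  qed
  \<comment> \<open>Starting at index 1 absorbs the shift \<open>j - 1\<close> of row 0, leaving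
    blocks of length \<open>M\<close>.\<close>
  moreover have "map (A 0) [1..<Suc (n * M)] = map (\<lambda>j. (\<lambda>k. c (u (Suc k))) (j div M)) [0..<n * M]"
    by (rule nth_equalityI) (simp_all add: A_def a_def del: upt_Suc)
  ultimately have closed: "closed_word (map (\<lambda>j. (\<lambda>k. c (u (Suc k))) (j div M)) [0..<n * M])" by simp
  have last: "last (map (\<lambda>j. c (u (Suc (j div M)))) [0..<n * M]) = last (map (\<lambda>k. c (u (Suc k))) [0..<n])"
    using n M(1) last_div by (simp add: last_conv_nth)
  show ?thesis
    using closed last foldl_push_dilate[OF M(1), of _ "\<lambda>k. c (u (Suc k))" n]
    unfolding closed_word_def by auto
qed

section \<open>Contracting the boundary loop inside the disk\<close>

theorem theorem15:
  fixes G :: "'a graph" and T :: "'a set set" and c :: "'a \<Rightarrow> 'c" and w :: "'c list"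
  assumes "combinatorial_polygon G"
    and "triangulates T G"
    and "boundary_word G c w"
    and "\<not> contractible_word w"
  shows "\<exists>t\<in>T. tricolor c t"
proof (rule ccontr)
  assume no_tricolor: "\<not> (\<exists>t\<in>T. tricolor c t)"
  obtain vs where vs: "distinct vs" "set vs = fst G" "cycle_edges vs = snd G" and w: "w = map c vs"
    using assms(3) unfolding boundary_word_def cyclic_order_def by blast
  define n where "n = length vs"
  \<comment> \<open>The cyclic order given by the polygon need not be \<open>vs\<close>; the vertex
    count transfers the bound on the length.\<close>
  have "card (fst G) \<ge> 3"
    using assms(1) distinct_card
    unfolding combinatorial_polygon_def combinatorial_ngon_def cyclic_order_def by metis
  then have n: "n \<ge> 3" using vs distinct_card unfolding n_def by metis
  define u where "u k = vs ! (k mod n)" for k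
  have edge: "u k \<noteq> u (Suc k) \<and> {u k, u (Suc k)} \<in> snd G" for k
  proof -
    have k: "k mod n < n" using n by simp
    have "k mod n \<noteq> Suc k mod n"
      using n by (auto simp: mod_Suc)
    moreover have "Suc k mod n < n" using n by simp
    ultimately have "u k \<noteq> u (Suc k)"
      using nth_eq_iff_index_eq[OF vs(1)] k by (simp add: u_def n_def)
    moreover have "u (Suc k) = vs ! ((k mod n + 1) mod n)" by (simp add: u_def mod_Suc_eq)
    then have "{u k, u (Suc k)} = {vs ! (k mod n), vs ! ((k mod n + 1) mod length vs)}"
      by (simp add: u_def n_def)
    then have "{u k, u (Suc k)} \<in> cycle_edges vs"
      using k unfolding cycle_edges_def n_def by blast
    ultimately show ?thesis using vs(3) by simp
  qed
  obtain f g where fg: "homeomorphism (cball (0::complex) 1) (realization (generated_complex T)) f g"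
    and bd: "f ` sphere 0 1 = realization (generated_complex (snd G))"
    and T: "finite T" "\<And>t. t \<in> T \<Longrightarrow> card t = 3"
    using assms(2) unfolding triangulates_def disk_with_boundary_def by blast
  have f: "continuous_on (cball 0 1) f" "f ` cball 0 1 = realization (generated_complex T)"
    and g: "continuous_on (realization (generated_complex T)) g"
      "g ` realization (generated_complex T) = cball 0 1"
    and inv: "\<And>y. y \<in> realization (generated_complex T) \<Longrightarrow> f (g y) = y"
    using fg unfolding homeomorphism_def by auto
  let ?J = "{1/2..real n + 1/2}"
  \<comment> \<open>The boundary loop, carried to the round disk by \<open>g\<close>, shrinks
    radially to the center; applying \<open>f\<close> gives the homotopy, which ends at
    \<open>f 0\<close>.\<close>
  let ?h = "\<lambda>x. of_real (1 - fst x) * g (edge_path u n (snd x))"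
  have path: "edge_path u n t \<in> realization (generated_complex T)" if "t \<in> ?J" for t
  proof -
    have "edge_path u n t \<in> realization (generated_complex (snd G))"
      using edge that by (intro edge_path_in_realization) auto
    also have "\<dots> \<subseteq> realization (generated_complex T)"
      unfolding bd[symmetric] f(2)[symmetric] by (intro image_mono) auto
    finally show ?thesis .
  qed
  have ball: "norm (g (edge_path u n t)) \<le> 1" if "t \<in> ?J" for t
    using path[OF that] g(2) by (metis imageI mem_cball_0)
  have h_ball: "?h ` ({0..1} \<times> ?J) \<subseteq> cball 0 1"
    using ball by (auto simp: norm_mult mult_le_one simp del: of_real_diff)
  have "continuous_on ({0..1} \<times> ?J) ?h"
    using path
    by (intro continuous_intros continuous_on_compose2[OF g(1)]
        continuous_on_compose2[OF continuous_on_edge_path[of UNIV]]) auto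
  then have "continuous_on ({0..1} \<times> ?J) (\<lambda>x. f (?h x))"
    using f(1) h_ball by (intro continuous_on_compose2[OF f(1)]) auto
  moreover have "(\<lambda>x. f (?h x)) ` ({0..1} \<times> ?J) \<subseteq> realization (generated_complex T)"
    using h_ball f(2) by blast
  \<comment> \<open>The times \<open>1/2\<close> and \<open>n + 1/2\<close> are midpoints of the
    edge from \<open>u 0\<close> to \<open>u 1\<close> and of its periodic copy starting at
    \<open>u n\<close>.\<close>
  moreover have "edge_path u n (real n + 1/2) = edge_path u n (1/2)"
    using edge_path_segment[of n n "1/2" u] edge_path_segment[of 0 n "1/2" u] n
    by (simp add: u_def mod_Suc)
  moreover have "u n = u 0" by (simp add: u_def)
  ultimately have "closed_word (map (\<lambda>k. c (u (Suc k))) [0..<n])"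
    using T no_tricolor n path inv
    by (intro closed_word_null_homotopic[where H = "\<lambda>x. f (?h x)" and q = "f 0" and T = T])
      simp_all
  \<comment> \<open>The loop reads off \<open>u 1\<close> up to \<open>u n\<close>, the boundary
    word rotated by one.\<close>
  moreover have "map (\<lambda>k. c (u (Suc k))) [0..<n] = rotate1 w"
    by (rule nth_equalityI) (simp_all add: u_def w n_def nth_rotate1 rotate1_map)
  moreover have "rotate1 w \<noteq> []" using n by (auto simp: w n_def)
  ultimately have "contractible_word (rotate1 w)"
    using closed_word_contractible by metis
  then show False
    using assms(4) contractible_word_rotate[of 1 w] by simp
qed

end
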